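(* Let $H$ be a Hadamard matrix of order $n$ and let $m$ be an integer with $n \ge m > 1$. Then the mean value $E(\det(M)^2)$ of $\det(M)^2$, taken over all $m\times m$ submatrices $M$ of $H$, satisfies $$E(\det(M)^2) > m!.$$
   Context: A Hadamard matrix of order $n$ is an $n\times n$ matrix $H$ with entries in $\{+1,-1\}$ satisfying $HH^T = nI$. An $m\times m$ submatrix of $H$ is obtained by choosing $m$ of the rows and $m$ of the columns (not necessarily consecutive). Submatrices are indexed by the choice of rows and columns, so there are exactly $\binom{n}{m}^2$ of them, and the mean is the uniform average over these choices. *)

theory Defs
  imports
    "Jordan_Normal_Form.Determinant"
    "Jordan_Normal_Form.DL_Submatrix"
    Complex_Main
begin

definition hadamard_matrix :: "nat \<Rightarrow> real mat \<Rightarrow> bool" where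
  "hadamard_matrix n H \<longleftrightarrow>
     H \<in> carrier_mat n n \<and>
     (\<forall>i<n. \<forall>j<n. H $$ (i, j) \<in> {1, -1}) \<and>
     H * transpose_mat H = real n \<cdot>\<^sub>m 1\<^sub>m n"

text \<open>
  A pair \<open>(I, J)\<close> stands for the submatrix \<open>submatrix H I J\<close> with row set \<open>I\<close> and column set
  \<open>J\<close> (rows and columns numbered from 0, kept in increasing order). Averages run over the
  choices, so submatrices that are equal as matrices but come from different choices are
  counted separately.
\<close>

definition submatrix_choices :: "nat \<Rightarrow> nat \<Rightarrow> (nat set \<times> nat set) set" where
  "submatrix_choices n m =
     {I. I \<subseteq> {..<n} \<and> card I = m} \<times> {J. J \<subseteq> {..<n} \<and> card J = m}"

definition mean_over :: "'a set \<Rightarrow> ('a \<Rightarrow> real) \<Rightarrow> real" where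
  "mean_over A f = (\<Sum>x\<in>A. f x) / real (card A)"

lemma finite_submatrix_choices: "finite (submatrix_choices n m)"
  by (simp add: submatrix_choices_def)

lemma card_submatrix_choices: "card (submatrix_choices n m) = (n choose m)\<^sup>2"
  by (simp add: submatrix_choices_def card_cartesian_product n_subsets power2_eq_square)

lemma submatrix_choices_carrier:
  assumes "H \<in> carrier_mat n n" and "(I, J) \<in> submatrix_choices n m"
  shows "submatrix H I J \<in> carrier_mat m m"
proof -
  have "I \<subseteq> {..<n}" "J \<subseteq> {..<n}" and cards: "card I = m" "card J = m"
    using assms(2) unfolding submatrix_choices_def by blast+
  then have "{i. i < n \<and> i \<in> I} = I" "{j. j < n \<and> j \<in> J} = J"
    by blast+
  moreover have "dim_row H = n" "dim_col H = n"
    using assms(1) by (rule carrier_matD)+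
  ultimately show ?thesis
    unfolding carrier_mat_def by (simp only: mem_Collect_eq dim_submatrix cards simp_thms)
qed

end

theory Submission
  imports Defs
begin

text \<open>
  Fix the set \<open>I\<close> of rows. By the Cauchy--Binet formula the squares of the maximal minors of the
  \<open>m \<times> n\<close> matrix \<open>A\<close> formed by these rows add up to \<open>det (A * A\<^sup>T) = det (n \<cdot> 1) = n ^ m\<close>. Hence the
  mean is \<open>n ^ m / (n choose m) = m! * n ^ m / (n * (n - 1) * \<dots> * (n - m + 1))\<close>, where the last
  quotient exceeds \<open>1\<close> as soon as \<open>m > 1\<close>.
\<close>

text \<open>Exactly \<open>i\<close> elements of \<open>J\<close> lie below \<open>pick J i\<close>,
  so \<open>pick J i\<close> determines \<open>i\<close>; counting then gives surjectivity.\<close>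

lemma bij_betw_pick:
  assumes "finite J"
  shows "bij_betw (pick J) {0..<card J} J"
proof -
  have "inj_on (pick J) {0..<card J}"
    by (rule inj_onI) (metis atLeastLessThan_iff card_pick_le)
  moreover have "pick J ` {0..<card J} \<subseteq> J"
    using pick_in_set_le by auto
  ultimately show ?thesis
    using assms by (simp add: bij_betw_def card_image card_subset_eq)
qed

text \<open>An injective map factors uniquely as a permutation of the positions followed by the
  increasing enumeration of its image. In the Cauchy--Binet formula this groups the injective index
  choices by their image. \<open>restrict\<close> makes the composite \<open>undefined\<close>
  outside \<open>{0..<m}\<close>, as \<open>\<rightarrow>\<^sub>E\<close> requires.\<close>

lemma bij_betw_pick_permutation:
  "bij_betw (\<lambda>(J, p). restrict (pick J \<circ> p) {0..<m})
     ({J. J \<subseteq> {..<n} \<and> card J = m} \<times> {p. p permutes {0..<m}})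
     {f \<in> {0..<m} \<rightarrow>\<^sub>E {..<n}. inj_on f {0..<m}}"
  (is "bij_betw ?g (?Js \<times> ?P) ?F")
proof -
  let ?U = "{0..<m}"
  have pick: "bij_betw (pick J) ?U J" if "J \<in> ?Js" for J
    using that bij_betw_pick[of J] finite_subset[of J "{..<n}"] by auto
  have comp: "bij_betw (pick J \<circ> p) ?U J" if "J \<in> ?Js" "p \<in> ?P" for J p
    using that by (intro bij_betw_trans[of p ?U ?U] pick) (auto simp: permutes_imp_bij)
  have "inj_on ?g (?Js \<times> ?P)"
  proof (rule inj_onI)
    fix x y
    assume xy: "x \<in> ?Js \<times> ?P" "y \<in> ?Js \<times> ?P" "?g x = ?g y"
    obtain J p K q where [simp]: "x = (J, p)" "y = (K, q)"
      by fastforce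
    have J: "J \<in> ?Js" "p \<in> ?P" and K: "K \<in> ?Js" "q \<in> ?P"
      using xy(1,2) by auto
    have eq: "pick J (p i) = pick K (q i)" if "i \<in> ?U" for i
      using fun_cong[OF xy(3), of i] that by simp
    \<comment> \<open>The set is recovered as the image of the composite. After that, injectivity of
      \<open>pick K\<close> recovers the permutation on \<open>?U\<close>; off \<open>?U\<close>
      both permutations are the identity.\<close>
    have "(pick J \<circ> p) ` ?U = (pick K \<circ> q) ` ?U"
      by (rule image_cong[OF refl]) (simp add: eq)
    then have JK: "J = K"
      using comp[OF J] comp[OF K] by (metis bij_betw_imp_surj_on)
    have "p i = q i" for i
    proof (cases "i \<in> ?U")
      case True
      moreover have "p i \<in> ?U" "q i \<in> ?U"
        using True J K by (auto simp: permutes_in_image simp del: atLeastLessThan_iff)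
      ultimately show ?thesis
        using eq[OF True] JK inj_onD[OF bij_betw_imp_inj_on[OF pick[OF K(1)]], of "p i" "q i"]
        by blast
    next
      case False
      then show ?thesis
        using J K by (simp add: permutes_def)
    qed
    then show "x = y"
      using JK by auto
  qed
  moreover have "?g ` (?Js \<times> ?P) = ?F"
  proof (intro equalityI subsetI)
    fix f
    assume "f \<in> ?g ` (?Js \<times> ?P)"
    then obtain J p where J: "J \<in> ?Js" "p \<in> ?P" and f: "f = restrict (pick J \<circ> p) ?U"
      by auto
    have "bij_betw f ?U J"
      unfolding f by (rule bij_betw_cong[THEN iffD1, OF _ comp[OF J]]) simp
    then have "inj_on f ?U" "f ` ?U \<subseteq> {..<n}"
      using J by (simp_all add: bij_betw_def)
    moreover have "f \<in> extensional ?U"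
      by (simp add: f)
    ultimately show "f \<in> ?F"
      by (simp add: PiE_def image_subset_iff_funcset)
  next
    fix f
    assume f: "f \<in> ?F"
    let ?J = "f ` ?U"
    \<comment> \<open>\<open>?p i\<close> is the rank of \<open>f i\<close> in the image of
      \<open>f\<close>, extended by the identity so that \<open>?p permutes ?U\<close>.\<close>
    let ?p = "\<lambda>i. if i \<in> ?U then inv_into ?U (pick ?J) (f i) else i"
    have J: "?J \<in> ?Js"
      using f by (auto simp: card_image)
    have "bij_betw f ?U ?J"
      using f by (simp add: bij_betw_def)
    then have "bij_betw (inv_into ?U (pick ?J) \<circ> f) ?U ?U"
      using bij_betw_inv_into[OF pick[OF J]] by (rule bij_betw_trans)
    then have "bij_betw ?p ?U ?U"
      by (rule bij_betw_cong[THEN iffD1, rotated]) simp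
    then have "?p permutes ?U"
      by (rule bij_imp_permutes) simp
    then have p: "?p \<in> ?P"
      by simp
    have "f = ?g (?J, ?p)"
    proof
      fix i
      show "f i = ?g (?J, ?p) i"
      proof (cases "i \<in> ?U")
        case True
        then have "pick ?J (inv_into ?U (pick ?J) (f i)) = f i"
          by (intro bij_betw_inv_into_right[OF pick[OF J]] imageI)
        then show ?thesis
          using True by (simp del: atLeastLessThan_iff)
      next
        case False
        moreover have "f i = undefined"
          using f False PiE_arb by fastforce
        ultimately show ?thesis
          by (simp only: prod.case restrict_apply if_False)
      qed
    qed
    then show "f \<in> ?g ` (?Js \<times> ?P)"
      by (rule image_eqI) (use J p in simp)
  qed
  ultimately show ?thesis
    by (simp add: bij_betw_def)
qed

text \<open>The Leibniz expansion of \<open>det (A * B)\<close> is multiplied out into a sum over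
  all maps \<open>f\<close> choosing one inner index per row. Non-injective \<open>f\<close>
  contribute zero, and the injective ones with image \<open>J\<close> add up to the product of the
  two minors at \<open>J\<close>.\<close>

theorem cauchy_binet:
  fixes A B :: "'a :: comm_ring_1 mat"
  assumes A: "A \<in> carrier_mat m n" and B: "B \<in> carrier_mat n m"
  shows "det (A * B) =
    (\<Sum>J | J \<subseteq> {..<n} \<and> card J = m. det (submatrix A UNIV J) * det (submatrix B J UNIV))"
proof -
  let ?U = "{0..<m}"
  let ?F = "?U \<rightarrow>\<^sub>E {..<n}"
  let ?P = "{p. p permutes ?U}"
  let ?Js = "{J. J \<subseteq> {..<n} \<and> card J = m}"
  \<comment> \<open>\<open>BR f\<close> lists the rows of \<open>B\<close> in the order given by
    \<open>f\<close>, with repetitions allowed.\<close>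
  define BR where "BR f = mat m m (\<lambda>(i, j). B $$ (f i, j))" for f
  have BR: "BR f \<in> carrier_mat m m" for f
    by (simp add: BR_def)
  have perm: "p i < m" if "p \<in> ?P" "i < m" for p i
    using that permutes_in_image[of p ?U i] by auto
  have det_BR: "det (BR f) = (\<Sum>p\<in>?P. signof p * (\<Prod>i\<in>?U. B $$ (f i, p i)))" for f
    unfolding det_def'[OF BR] by (intro sum.cong refl) (simp add: BR_def perm)
  have "det (A * B) = (\<Sum>p\<in>?P. signof p * (\<Prod>i\<in>?U. \<Sum>k\<in>{..<n}. A $$ (i, k) * B $$ (k, p i)))"
    using A B unfolding det_def'[OF mult_carrier_mat[OF A B]]
    by (intro sum.cong refl)
      (simp add: perm scalar_prod_def lessThan_atLeast0)
  also have "\<dots> = (\<Sum>p\<in>?P. signof p * (\<Sum>f\<in>?F. \<Prod>i\<in>?U. A $$ (i, f i) * B $$ (f i, p i)))"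
    by (simp add: prod_sum_PiE)
  \<comment> \<open>The entries of \<open>A\<close> do not depend on \<open>p\<close>; what remains
    of the sum over \<open>p\<close> is the Leibniz formula for \<open>BR f\<close>.\<close>
  also have "\<dots> = (\<Sum>f\<in>?F. (\<Prod>i\<in>?U. A $$ (i, f i)) * det (BR f))"
    unfolding det_BR sum_distrib_left
    by (subst sum.swap) (simp add: prod.distrib mult_ac)
  \<comment> \<open>If \<open>f\<close> takes a value twice, \<open>BR f\<close> has two equal
    rows.\<close>
  also have "\<dots> = (\<Sum>f\<in>{f \<in> ?F. inj_on f ?U}. (\<Prod>i\<in>?U. A $$ (i, f i)) * det (BR f))"
  proof (rule sum.mono_neutral_right)
    show "\<forall>f\<in>?F - {f \<in> ?F. inj_on f ?U}. (\<Prod>i\<in>?U. A $$ (i, f i)) * det (BR f) = 0"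
    proof
      fix f
      assume "f \<in> ?F - {f \<in> ?F. inj_on f ?U}"
      then obtain i j where ij: "i < m" "j < m" "i \<noteq> j" "f i = f j"
        by (auto simp: inj_on_def)
      then have "row (BR f) i = row (BR f) j"
        by (auto simp: BR_def)
      then show "(\<Prod>i\<in>?U. A $$ (i, f i)) * det (BR f) = 0"
        using det_identical_rows[OF BR ij(3,1,2)] by simp
    qed
  qed (auto intro: finite_PiE)
  also have "\<dots> = (\<Sum>(J, p)\<in>?Js \<times> ?P.
      (\<Prod>i\<in>?U. A $$ (i, pick J (p i))) * det (BR (pick J \<circ> p)))"
    unfolding sum.reindex_bij_betw[OF bij_betw_pick_permutation, symmetric]
    by (intro sum.cong refl) (auto simp: BR_def intro!: arg_cong[of _ _ det] arg_cong2[of _ _ _ _ "(*)"])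
  also have "\<dots> = (\<Sum>J\<in>?Js. \<Sum>p\<in>?P.
      (\<Prod>i\<in>?U. A $$ (i, pick J (p i))) * det (BR (pick J \<circ> p)))"
    by (simp add: sum.cartesian_product)
  also have "\<dots> = (\<Sum>J\<in>?Js. det (submatrix A UNIV J) * det (submatrix B J UNIV))"
  proof (intro sum.cong refl)
    fix J
    assume J: "J \<in> ?Js"
    then have cJ: "card {j. j < n \<and> j \<in> J} = m"
      by (auto intro!: arg_cong[of _ _ card])
    have AJ: "submatrix A UNIV J = mat m m (\<lambda>(i, j). A $$ (i, pick J j))"
      using A cJ by (auto simp: submatrix_def pick_UNIV)
    have BJ: "submatrix B J UNIV = BR (pick J)"
      using B cJ by (auto simp: submatrix_def pick_UNIV BR_def)
    \<comment> \<open>Sorting the rows of \<open>B\<close> costs the sign of \<open>p\<close>. This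
      sign turns the remaining sum over \<open>p\<close> into the Leibniz formula for the minor of
      \<open>A\<close>.\<close>
    have det_perm: "det (BR (pick J \<circ> p)) = signof p * det (BR (pick J))" if "p \<in> ?P" for p
    proof -
      have "BR (pick J \<circ> p) = mat m m (\<lambda>(i, j). BR (pick J) $$ (p i, j))"
        using that by (auto simp: BR_def perm)
      then show ?thesis
        using det_permute_rows[OF BR] that by simp
    qed
    have "(\<Sum>p\<in>?P. (\<Prod>i\<in>?U. A $$ (i, pick J (p i))) * det (BR (pick J \<circ> p))) =
        (\<Sum>p\<in>?P. signof p * (\<Prod>i\<in>?U. A $$ (i, pick J (p i)))) * det (BR (pick J))"
      unfolding sum_distrib_right by (intro sum.cong refl) (simp only: det_perm mult_ac)
    also have "(\<Sum>p\<in>?P. signof p * (\<Prod>i\<in>?U. A $$ (i, pick J (p i)))) = det (submatrix A UNIV J)"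
      unfolding AJ det_def'[OF mat_carrier]
      by (intro sum.cong refl) (simp add: perm)
    finally show "(\<Sum>p\<in>?P. (\<Prod>i\<in>?U. A $$ (i, pick J (p i))) * det (BR (pick J \<circ> p))) =
        det (submatrix A UNIV J) * det (submatrix B J UNIV)"
      unfolding BJ .
  qed
  finally show ?thesis .
qed

text \<open>The chosen rows are still pairwise orthogonal with squared length \<open>c\<close>, so
  their Gram matrix is scalar with determinant \<open>c ^ m\<close>, and Cauchy--Binet expands this
  determinant.\<close>

lemma sum_det_submatrix_squared:
  fixes H :: "real mat"
  assumes H: "H \<in> carrier_mat n n" and orth: "H * transpose_mat H = c \<cdot>\<^sub>m 1\<^sub>m n"
    and I: "I \<subseteq> {..<n}" "card I = m"
  shows "(\<Sum>J | J \<subseteq> {..<n} \<and> card J = m. (det (submatrix H I J))\<^sup>2) = c ^ m"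
proof -
  let ?A = "submatrix H I UNIV"
  let ?Js = "{J. J \<subseteq> {..<n} \<and> card J = m}"
  have "{i. i < n \<and> i \<in> I} = I"
    using I by blast
  then have A_eq: "?A = mat m n (\<lambda>(i, j). H $$ (pick I i, j))"
    using H I by (auto simp: submatrix_def pick_UNIV)
  then have A: "?A \<in> carrier_mat m n"
    by simp
  have pick: "bij_betw (pick I) {0..<m} I"
    using I bij_betw_pick[of I] finite_subset[of I "{..<n}"] by auto
  then have pick_less: "pick I i < n" if "i < m" for i
    using that I by (auto simp: bij_betw_def)
  have gram: "?A * transpose_mat ?A = c \<cdot>\<^sub>m 1\<^sub>m m"
  proof (rule eq_matI)
    fix i j
    assume "i < dim_row (c \<cdot>\<^sub>m 1\<^sub>m m)" "j < dim_col (c \<cdot>\<^sub>m 1\<^sub>m m)"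
    then have ij: "i < m" "j < m"
      by auto
    have "(?A * transpose_mat ?A) $$ (i, j) = (H * transpose_mat H) $$ (pick I i, pick I j)"
      using H ij pick_less by (simp add: A_eq scalar_prod_def)
    \<comment> \<open>Since \<open>pick I\<close> is injective, off-diagonal entries come from
      off-diagonal entries.\<close>
    also have "\<dots> = (c \<cdot>\<^sub>m 1\<^sub>m m) $$ (i, j)"
      using pick ij pick_less by (auto simp: orth bij_betw_def inj_on_eq_iff)
    finally show "(?A * transpose_mat ?A) $$ (i, j) = (c \<cdot>\<^sub>m 1\<^sub>m m) $$ (i, j)" .
  qed (use A in auto)
  have "c ^ m = det (?A * transpose_mat ?A)"
    by (simp add: gram)
  also have "\<dots> = (\<Sum>J\<in>?Js. (det (submatrix H I J))\<^sup>2)"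
    unfolding cauchy_binet[OF A transpose_carrier_mat[THEN iffD2, OF A]]
  proof (intro sum.cong refl)
    fix J
    assume J: "J \<in> ?Js"
    have HIJ: "submatrix H I J \<in> carrier_mat m m"
      using I J by (intro submatrix_choices_carrier[OF H]) (simp add: submatrix_choices_def)
    have 1: "submatrix ?A UNIV J = submatrix H I J"
      using pick_le by (auto simp: submatrix_def pick_UNIV)
    \<comment> \<open>The second Cauchy--Binet factor is the transpose of the first, which makes
      their product a square.\<close>
    have 2: "submatrix (transpose_mat ?A) J UNIV = transpose_mat (submatrix ?A UNIV J)"
      using pick_le by (auto simp: submatrix_def pick_UNIV)
    show "det (submatrix ?A UNIV J) * det (submatrix (transpose_mat ?A) J UNIV) =
        (det (submatrix H I J))\<^sup>2"
      unfolding 2 unfolding 1 det_transpose[OF HIJ] by (simp add: power2_eq_square)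
  qed
  finally show ?thesis ..
qed

text \<open>The left side is the falling factorial
  \<open>n * (n - 1) * \<dots> * (n - m + 1)\<close>. Its first factor equals \<open>n\<close>, and
  since \<open>1 < m\<close> there is at least one further factor, all of them at most
  \<open>n - 1\<close>.\<close>

lemma binomial_fact_less_pow:
  assumes "1 < m" "m \<le> n"
  shows "(n choose m) * fact m < n ^ m"
proof -
  obtain k where m: "m = Suc k" "0 < k"
    using assms by (cases m) auto
  obtain l where n: "n = Suc l"
    using assms by (cases n) auto
  have "(n choose m) * fact m = (Suc k * (Suc l choose Suc k)) * fact k"
    by (simp add: m n algebra_simps del: binomial_Suc_Suc)
  \<comment> \<open>The absorption identity splits off the leading factor \<open>n\<close>.\<close>
  also have "\<dots> = n * ((l choose k) * fact k)"
    by (simp only: Suc_times_binomial n mult.assoc)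
  also have "\<dots> \<le> n * l ^ k"
    using binomial_fact_pow by simp
  \<comment> \<open>Strictness comes from \<open>l < n\<close> together with
    \<open>0 < k\<close>.\<close>
  also have "\<dots> < n * n ^ k"
    using m n by (intro mult_strict_left_mono power_strict_mono) auto
  finally show ?thesis
    by (simp add: m)
qed

theorem corollary1:
  fixes H :: "real mat" and n m :: nat
  assumes "hadamard_matrix n H"
    and "n \<ge> m" and "m > 1"
  shows "mean_over (submatrix_choices n m) (\<lambda>(I, J). (det (submatrix H I J))\<^sup>2) > fact m"
proof -
  let ?S = "{I. I \<subseteq> {..<n} \<and> card I = m}"
  let ?b = "real (n choose m)"
  have H: "H \<in> carrier_mat n n" "H * transpose_mat H = real n \<cdot>\<^sub>m 1\<^sub>m n"
    using assms(1) by (auto simp: hadamard_matrix_def)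
  have b: "?b > 0"
    using assms by simp
  have "(\<Sum>(I, J)\<in>submatrix_choices n m. (det (submatrix H I J))\<^sup>2) =
      (\<Sum>I\<in>?S. \<Sum>J\<in>?S. (det (submatrix H I J))\<^sup>2)"
    unfolding submatrix_choices_def by (simp add: sum.cartesian_product)
  \<comment> \<open>Each of the \<open>?b\<close> row sets contributes the same total; dividing by
    \<open>?b\<close> squared leaves one \<open>?b\<close> in the denominator.\<close>
  also have "\<dots> = ?b * real n ^ m"
    by (simp add: sum_det_submatrix_squared[OF H] n_subsets)
  finally have "mean_over (submatrix_choices n m) (\<lambda>(I, J). (det (submatrix H I J))\<^sup>2) =
      real n ^ m / ?b"
    using b by (simp add: mean_over_def card_submatrix_choices power2_eq_square)
  moreover have "?b * fact m < real n ^ m"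
    using binomial_fact_less_pow[OF assms(3,2)]
    by (metis of_nat_fact of_nat_less_iff of_nat_mult of_nat_power)
  ultimately show ?thesis
    using b by (simp add: less_divide_eq mult.commute)
qed

end
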